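(* Let $m$ be a fixed positive integer. The generating function for the number $c_m(n)$ of monotone paths of length $n$ in the strip of height $m$ is \[ \sum_{n \geq 0} c_m(n)x^n = \frac{\det(I-x A_m \, ; \, 00)}{\det(I-x A_m)}, \] where $(I-xA_m \, ; \, 00)$ is the matrix obtained from $I-xA_m$ by replacing every entry in the first column (the column indexed by $(0,0)$) with a $1$.
   Context: The strip of height $m$ is $\{(x,y)\in\mathbb{Z}^2 : x\ge 0,\ 0\le y\le m\}$. A monotone path of length $n$ in the strip of height $m$ is a lattice path that starts at $(0,0)$, takes $n$ steps, each equal to $N=(0,1)$, $S=(0,-1)$ or $E=(1,0)$, never retraces steps (no $N$ immediately followed by $S$ and no $S$ immediately by $N$), and stays within the strip; $c_m(n)$ is their number ($c_m(0)=1$). The transfer graph $G_m$ is the directed graph whose vertices are the pairs $(i,j)$ with $i,j\in\{0,\dots,m\}$ and $j\in\{i-1,i,i+1\}$, with an edge $(i,j)\to(j,k)$ for all such vertices unless $j=i\pm1$ and $k=i$ (loops allowed). $A_m$ is its adjacency matrix, with rows and columns indexed by the vertices and the vertex $(0,0)$ listed first. *)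

theory Defs
  imports
    "HOL-Library.Product_Plus"
    "HOL-Computational_Algebra.Formal_Power_Series"
    "Graph_Theory.Pair_Digraph"
    "Jordan_Normal_Form.Determinant"
begin

definition strip :: "nat \<Rightarrow> (int \<times> int) set" where
  "strip m = {(x, y). 0 \<le> x \<and> 0 \<le> y \<and> y \<le> int m}"

datatype step = North | South | East

fun step_vector :: "step \<Rightarrow> int \<times> int" where
  "step_vector North = (0, 1)"
| "step_vector South = (0, -1)"
| "step_vector East = (1, 0)"

text \<open>A lattice path from the origin is encoded by its list of steps; the following is the
  point reached after the first k steps.\<close>

definition path_point :: "step list \<Rightarrow> nat \<Rightarrow> int \<times> int" where
  "path_point w k = sum_list (map step_vector (take k w))"

definition monotone_paths :: "nat \<Rightarrow> nat \<Rightarrow> step list set" where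
  "monotone_paths m n = {w. length w = n
     \<and> (\<forall>k \<le> n. path_point w k \<in> strip m)
     \<and> (\<forall>k. Suc k < n \<longrightarrow> (w ! k, w ! Suc k) \<notin> {(North, South), (South, North)})}"

definition num_monotone_paths :: "nat \<Rightarrow> nat \<Rightarrow> nat" where
  "num_monotone_paths m n = card (monotone_paths m n)"

definition transfer_vertices :: "nat \<Rightarrow> (int \<times> int) set" where
  "transfer_vertices m =
     {(i, j). i \<in> {0..int m} \<and> j \<in> {0..int m} \<and> j \<in> {i - 1, i, i + 1}}"

definition transfer_graph :: "nat \<Rightarrow> (int \<times> int) pair_pre_digraph" where
  "transfer_graph m = \<lparr>
     pverts = transfer_vertices m,
     parcs = {((i, j), (j, k)) | i j k.
       (i, j) \<in> transfer_vertices m \<and> (j, k) \<in> transfer_vertices m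
       \<and> \<not> ((j = i + 1 \<or> j = i - 1) \<and> k = i)} \<rparr>"

text \<open>Rows and columns follow the order of the vertex list vs, which is meant to list every
  vertex exactly once.\<close>

definition adjacency_matrix ::
    "'a pair_pre_digraph \<Rightarrow> 'a list \<Rightarrow> 'b :: zero_neq_one mat" where
  "adjacency_matrix G vs = mat (length vs) (length vs)
     (\<lambda>(a, b). if (vs ! a, vs ! b) \<in> parcs G then 1 else 0)"

definition is_transfer_enumeration :: "nat \<Rightarrow> (int \<times> int) list \<Rightarrow> bool" where
  "is_transfer_enumeration m vs \<longleftrightarrow>
     distinct vs \<and> set vs = pverts (transfer_graph m) \<and> hd vs = (0, 0)"

lemma ex_transfer_enumeration: "\<exists>vs. is_transfer_enumeration m vs"
proof -
  have "transfer_vertices m \<subseteq> {0..int m} \<times> {0..int m}"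
    by (auto simp: transfer_vertices_def)
  then have "finite (transfer_vertices m - {(0, 0)})"
    using finite_subset by fastforce
  then obtain ws where "distinct ws" "set ws = transfer_vertices m - {(0, 0)}"
    using finite_distinct_list by metis
  moreover have "(0, 0) \<in> transfer_vertices m"
    by (simp add: transfer_vertices_def)
  ultimately have "is_transfer_enumeration m ((0, 0) # ws)"
    by (auto simp: is_transfer_enumeration_def transfer_graph_def)
  then show ?thesis ..
qed

text \<open>The matrix I - xA over the ring of formal power series in x.\<close>

definition transfer_matrix :: "nat \<Rightarrow> (int \<times> int) list \<Rightarrow> rat fps mat" where
  "transfer_matrix m vs =
     1\<^sub>m (length vs) - fps_X \<cdot>\<^sub>m adjacency_matrix (transfer_graph m) vs"

end

theory Submission
  imports Defs
begin

text \<open>A monotone path is determined by its sequence of heights, and recording each step as the pair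
  of heights before and after it turns monotone paths of length \<open>n\<close> into walks of length \<open>n\<close> in the
  transfer graph that start at \<open>(0, 0)\<close>: that vertex plays the role of an East step preceding the
  path. Splitting off the first edge of a walk shows that the generating functions of
  the walks from the various vertices solve the linear system \<open>(I - x A) f = 1\<close>, and Cramer's rule
  gives the component at \<open>(0, 0)\<close>. The determinant of \<open>I - x A\<close> has constant term 1.\<close>

section \<open>Generating functions of walks in a directed graph\<close>

fun num_walks :: "'a pair_pre_digraph \<Rightarrow> 'a \<Rightarrow> nat \<Rightarrow> nat" where
  "num_walks G v 0 = 1"
| "num_walks G v (Suc n) = (\<Sum>u | (v, u) \<in> parcs G. num_walks G u n)"

definition walk_fps :: "'a pair_pre_digraph \<Rightarrow> 'a \<Rightarrow> 'b :: comm_ring_1 fps" where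
  "walk_fps G v = Abs_fps (\<lambda>n. of_nat (num_walks G v n))"

text \<open>The summand 1 counts the empty walk, and the factor \<open>fps_X\<close> records the
  first edge of every other walk.\<close>

lemma walk_fps_rec:
  assumes "finite {u. (v, u) \<in> parcs G}"
  shows "walk_fps G v = 1 + fps_X * (\<Sum>u | (v, u) \<in> parcs G. walk_fps G u)"
proof (rule fps_ext)
  fix n
  show "fps_nth (walk_fps G v) n = fps_nth (1 + fps_X * (\<Sum>u | (v, u) \<in> parcs G. walk_fps G u)) n"
    by (cases n) (simp_all add: walk_fps_def fps_sum_nth)
qed

lemma adjacency_matrix_carrier [simp]:
  "adjacency_matrix G vs \<in> carrier_mat (length vs) (length vs)"
  by (simp add: adjacency_matrix_def)

text \<open>Row \<open>a\<close> is the indicator of the out-neighbours of \<open>vs ! a\<close>.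
  Distinctness turns the sum over indices into one over vertices, and the second assumption ensures
  that no out-neighbour is missed.\<close>

lemma scalar_prod_row_adjacency_matrix:
  fixes f :: "'a \<Rightarrow> 'b :: comm_ring_1"
  assumes "distinct vs" "snd ` parcs G \<subseteq> set vs" "a < length vs"
  shows "row (adjacency_matrix G vs) a \<bullet> vec (length vs) (\<lambda>b. f (vs ! b)) =
    (\<Sum>u | (vs ! a, u) \<in> parcs G. f u)"
proof -
  have "row (adjacency_matrix G vs) a \<bullet> vec (length vs) (\<lambda>b. f (vs ! b)) =
      (\<Sum>b = 0..<length vs. if (vs ! a, vs ! b) \<in> parcs G then f (vs ! b) else 0)"
    using assms(3) by (auto simp: adjacency_matrix_def scalar_prod_def intro!: sum.cong)
  also have "\<dots> = (\<Sum>u\<in>set vs. if (vs ! a, u) \<in> parcs G then f u else 0)"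
    using assms(1) by (intro sum.reindex_bij_betw bij_betw_nth) auto
  also have "\<dots> = (\<Sum>u | u \<in> set vs \<and> (vs ! a, u) \<in> parcs G. f u)"
    by (simp add: sum.inter_filter)
  also have "{u. u \<in> set vs \<and> (vs ! a, u) \<in> parcs G} = {u. (vs ! a, u) \<in> parcs G}"
    using assms(2) by force
  finally show ?thesis .
qed

lemma smult_mat_mult_vec:
  fixes A :: "'a :: comm_semiring_1 mat"
  assumes "A \<in> carrier_mat nr nc" "v \<in> carrier_vec nc"
  shows "(c \<cdot>\<^sub>m A) *\<^sub>v v = c \<cdot>\<^sub>v (A *\<^sub>v v)"
  using assms by (intro eq_vecI) (auto simp: scalar_prod_def sum_distrib_left mult.assoc)

text \<open>Taking constant terms is a ring homomorphism, so it commutes with \<open>det\<close>,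
  and it sends the matrix to the identity.\<close>

lemma det_one_minus_X_smult_nth_0:
  fixes A :: "'a :: comm_ring_1 fps mat"
  assumes "A \<in> carrier_mat n n"
  shows "fps_nth (det (1\<^sub>m n - fps_X \<cdot>\<^sub>m A)) 0 = 1"
proof -
  interpret constant_term: comm_ring_hom "\<lambda>f :: 'a fps. fps_nth f 0"
    by unfold_locales simp_all
  have "map_mat (\<lambda>f. fps_nth f 0) (1\<^sub>m n - fps_X \<cdot>\<^sub>m A) = 1\<^sub>m n"
    using assms by (intro eq_matI) auto
  then show ?thesis
    by (metis constant_term.hom_det det_one)
qed

text \<open>Cramer's rule in product form: no division occurs, so any commutative ring of
  coefficients will do.\<close>

theorem walk_fps_times_det:
  fixes G :: "'a pair_pre_digraph" and vs :: "'a list"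
  defines "M \<equiv> 1\<^sub>m (length vs) - fps_X \<cdot>\<^sub>m (adjacency_matrix G vs :: 'b :: comm_ring_1 fps mat)"
  assumes "distinct vs" "snd ` parcs G \<subseteq> set vs" "k < length vs"
  shows "walk_fps G (vs ! k) * det M = det (replace_col M (vec (length vs) (\<lambda>_. 1)) k)"
proof -
  define f :: "'b fps vec" where "f = vec (length vs) (\<lambda>b. walk_fps G (vs ! b))"
  let ?A = "adjacency_matrix G vs :: 'b fps mat"
  have f: "f \<in> carrier_vec (length vs)"
    by (simp add: f_def)
  have M: "M \<in> carrier_mat (length vs) (length vs)"
    by (simp add: M_def minus_carrier_mat)
  have "M *\<^sub>v f = f - fps_X \<cdot>\<^sub>v (?A *\<^sub>v f)"
    using f by (simp add: M_def minus_mult_distrib_mat_vec[of _ "length vs" "length vs"]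
        smult_mat_mult_vec[of _ "length vs" "length vs"])
  also have "\<dots> = vec (length vs) (\<lambda>_. 1)"
  proof (rule eq_vecI)
    fix a assume "a < dim_vec (vec (length vs) (\<lambda>_. 1 :: 'b fps))"
    then have a: "a < length vs" by simp
    have "finite {u. (vs ! a, u) \<in> parcs G}"
      by (rule finite_subset[OF _ finite_set[of vs]]) (use assms(3) in force)
    from walk_fps_rec[OF this, where 'b = 'b]
    have "walk_fps G (vs ! a) - fps_X * (row ?A a \<bullet> f) = 1"
      using scalar_prod_row_adjacency_matrix[OF assms(2,3) a, of "walk_fps G :: 'a \<Rightarrow> 'b fps"]
      by (simp add: f_def algebra_simps)
    with a show "(f - fps_X \<cdot>\<^sub>v (?A *\<^sub>v f)) $ a = vec (length vs) (\<lambda>_. 1) $ a"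
      by (simp add: f_def adjacency_matrix_def)
  qed (simp add: adjacency_matrix_def)
  finally have "M *\<^sub>v f = vec (length vs) (\<lambda>_. 1)" .
  \<comment> \<open>The Cramer lemma puts \<open>M *\<^sub>v f\<close> into column \<open>k\<close>;
    by the previous step this is the all-ones vector.\<close>
  with cramer_lemma_mat[OF M f assms(4)] show ?thesis
    using assms(4) by (simp add: f_def)
qed

section \<open>Monotone paths as walks in the transfer graph\<close>

text \<open>A vertex \<open>(i, j)\<close> stands for a path currently at height \<open>j\<close> whose last step came from height
  \<open>i\<close>; the last condition forbids the next step to retrace that one.\<close>

definition continuations :: "nat \<Rightarrow> int \<times> int \<Rightarrow> nat \<Rightarrow> step list set" where
  "continuations m v n = {w. length w = n
     \<and> (\<forall>k \<le> n. 0 \<le> snd v + snd (path_point w k) \<and> snd v + snd (path_point w k) \<le> int m)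
     \<and> (\<forall>k. Suc k < n \<longrightarrow> (w ! k, w ! Suc k) \<notin> {(North, South), (South, North)})
     \<and> (n > 0 \<longrightarrow> \<not> ((snd v = fst v + 1 \<or> snd v = fst v - 1)
          \<and> snd v + snd (step_vector (w ! 0)) = fst v))}"

lemma path_point_0 [simp]: "path_point w 0 = 0"
  by (simp add: path_point_def)

lemma path_point_Cons_Suc [simp]:
  "path_point (s # w) (Suc k) = step_vector s + path_point w k"
  by (simp add: path_point_def)

text \<open>No step goes left, so a path lies in the strip exactly when its heights stay between 0
  and \<open>m\<close>.\<close>

lemma path_point_horizontal_nonneg: "0 \<le> fst (path_point w k)"
proof -
  have "0 \<le> fst (sum_list (map step_vector w))" for w
  proof (induction w)
    case (Cons s w)
    then show ?case by (cases s) auto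
  qed simp
  then show ?thesis by (simp add: path_point_def)
qed

text \<open>The two entries of \<open>(0, 0)\<close> agree, so this start vertex forbids no first
  step.\<close>

lemma monotone_paths_eq_continuations: "monotone_paths m n = continuations m (0, 0) n"
  using path_point_horizontal_nonneg
  by (auto simp: monotone_paths_def continuations_def strip_def mem_Times_iff case_prod_beta)

lemma transfer_graph_arc_iff:
  "((i, j), (j', k)) \<in> parcs (transfer_graph m) \<longleftrightarrow>
     j' = j \<and> (i, j) \<in> transfer_vertices m \<and> (j, k) \<in> transfer_vertices m
     \<and> \<not> ((j = i + 1 \<or> j = i - 1) \<and> k = i)"
  by (auto simp: transfer_graph_def)

lemma all_le_Suc_iff: "(\<forall>k \<le> Suc n. P k) \<longleftrightarrow> P 0 \<and> (\<forall>k \<le> n. P (Suc k))"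
proof (intro iffI conjI allI impI)
  fix k assume "P 0 \<and> (\<forall>k \<le> n. P (Suc k))" "k \<le> Suc n"
  then show "P k" by (cases k) auto
qed auto

lemma all_Suc_less_Suc_iff:
  "(\<forall>k. Suc k < Suc n \<longrightarrow> P k) \<longleftrightarrow> (n > 0 \<longrightarrow> P 0) \<and> (\<forall>k. Suc k < n \<longrightarrow> P (Suc k))"
proof (intro iffI conjI allI impI)
  fix k assume "(n > 0 \<longrightarrow> P 0) \<and> (\<forall>k. Suc k < n \<longrightarrow> P (Suc k))" "Suc k < Suc n"
  then show "P k" by (cases k) auto
qed auto

text \<open>The pair \<open>u s\<close> holds the heights before and after the step
  \<open>s\<close>. The restriction that \<open>v\<close> puts on \<open>s\<close> becomes part of
  the arc condition, while the ban on \<open>w\<close> retracing \<open>s\<close> becomes the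
  restriction imposed by \<open>u s\<close>.\<close>

lemma Cons_in_continuations_iff:
  assumes "v \<in> transfer_vertices m"
  defines "u s \<equiv> (snd v, snd v + snd (step_vector s))"
  shows "s # w \<in> continuations m v (Suc n) \<longleftrightarrow>
    (v, u s) \<in> parcs (transfer_graph m) \<and> w \<in> continuations m (u s) n"
proof -
  have v: "(fst v, snd v) \<in> transfer_vertices m"
    using assms(1) by simp
  have "snd (step_vector s) \<in> {-1, 0, 1}"
    by (cases s) auto
  with v have vertex: "u s \<in> transfer_vertices m \<longleftrightarrow> 0 \<le> snd (u s) \<and> snd (u s) \<le> int m"
    by (auto simp: u_def transfer_vertices_def)
  have arc: "(v, u s) \<in> parcs (transfer_graph m) \<longleftrightarrow> u s \<in> transfer_vertices m
      \<and> \<not> ((snd v = fst v + 1 \<or> snd v = fst v - 1) \<and> snd v + snd (step_vector s) = fst v)"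
    using v transfer_graph_arc_iff[of "fst v" "snd v" "fst (u s)" "snd (u s)" m]
    by (simp add: u_def)
  have heights: "(\<forall>k \<le> Suc n. 0 \<le> snd v + snd (path_point (s # w) k)
        \<and> snd v + snd (path_point (s # w) k) \<le> int m) \<longleftrightarrow>
      u s \<in> transfer_vertices m \<and> (\<forall>k \<le> n. 0 \<le> snd (u s) + snd (path_point w k)
        \<and> snd (u s) + snd (path_point w k) \<le> int m)" (is "?L \<longleftrightarrow> _ \<and> ?R")
  proof -
    \<comment> \<open>The index 0 on the left concerns only the height of \<open>v\<close>, which is
      in range; the other indices shift by one.\<close>
    have "?L \<longleftrightarrow> ?R"
      using v unfolding all_le_Suc_iff by (simp add: u_def transfer_vertices_def case_prod_beta add.assoc)
    \<comment> \<open>The index 0 in \<open>?R\<close> bounds the height reached by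
      \<open>s\<close>.\<close>
    moreover have "?R \<Longrightarrow> u s \<in> transfer_vertices m"
      unfolding vertex by (metis add.right_neutral le0 path_point_0 snd_zero)
    ultimately show ?thesis by blast
  qed
  \<comment> \<open>Retracing in terms of heights: \<open>s\<close> changes the height and
    \<open>t\<close> restores it.\<close>
  have reversal: "(s, t) \<in> {(North, South), (South, North)} \<longleftrightarrow>
      (snd (u s) = fst (u s) + 1 \<or> snd (u s) = fst (u s) - 1)
        \<and> snd (u s) + snd (step_vector t) = fst (u s)" for t
    by (cases s; cases t) (auto simp: u_def)
  have reversals: "(\<forall>k. Suc k < Suc n \<longrightarrow>
        ((s # w) ! k, (s # w) ! Suc k) \<notin> {(North, South), (South, North)}) \<longleftrightarrow>
      (n > 0 \<longrightarrow> \<not> ((snd (u s) = fst (u s) + 1 \<or> snd (u s) = fst (u s) - 1)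
        \<and> snd (u s) + snd (step_vector (w ! 0)) = fst (u s)))
      \<and> (\<forall>k. Suc k < n \<longrightarrow> (w ! k, w ! Suc k) \<notin> {(North, South), (South, North)})"
    unfolding all_Suc_less_Suc_iff nth_Cons_0 nth_Cons_Suc reversal ..
  show ?thesis
    unfolding continuations_def mem_Collect_eq heights arc reversals
      length_Cons nth_Cons_0 nat.inject
    by (simp only: zero_less_Suc simp_thms conj_ac)
qed

lemma transfer_graph_arc_heights:
  assumes "(v, u) \<in> parcs (transfer_graph m)"
  shows "v \<in> transfer_vertices m" "u \<in> transfer_vertices m" "fst u = snd v"
  using assms by (auto simp: transfer_graph_def)

lemma finite_transfer_vertices: "finite (transfer_vertices m)"
  by (rule finite_subset[of _ "{0..int m} \<times> {0..int m}"]) (auto simp: transfer_vertices_def)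

lemma finite_continuations: "finite (continuations m v n)"
proof (rule finite_subset)
  show "finite {w. set w \<subseteq> {North, South, East} \<and> length w = n}"
    by (intro finite_lists_length_eq) simp
  show "continuations m v n \<subseteq> {w. set w \<subseteq> {North, South, East} \<and> length w = n}"
    using step.exhaust by (auto simp: continuations_def)
qed

text \<open>This recovers a step from its pair of heights; for a vertex, the last branch is the case
  of equal heights.\<close>

definition step_along :: "int \<times> int \<Rightarrow> step" where
  "step_along v = (if snd v = fst v + 1 then North else if snd v = fst v - 1 then South else East)"

lemma snd_step_vector_step_along:
  "v \<in> transfer_vertices m \<Longrightarrow> snd (step_vector (step_along v)) = snd v - fst v"
  by (auto simp: step_along_def transfer_vertices_def)

lemma step_along_step_vector: "step_along (j, j + snd (step_vector s)) = s"
  by (cases s) (auto simp: step_along_def)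

lemma continuations_Suc:
  assumes "v \<in> transfer_vertices m"
  shows "continuations m v (Suc n) =
    (\<Union>u\<in>{u. (v, u) \<in> parcs (transfer_graph m)}. Cons (step_along u) ` continuations m u n)"
    (is "?L = ?R")
proof (rule Set.set_eqI)
  fix w
  show "w \<in> ?L \<longleftrightarrow> w \<in> ?R"
  proof (cases w)
    case Nil
    then show ?thesis by (auto simp: continuations_def)
  next
    case (Cons s w')
    \<comment> \<open>Among the arcs leaving \<open>v\<close>, the step and the end vertex determine
      each other.\<close>
    have target: "(v, u) \<in> parcs (transfer_graph m) \<and> s = step_along u \<longleftrightarrow>
        (v, u) \<in> parcs (transfer_graph m) \<and> u = (snd v, snd v + snd (step_vector s))" for u
    proof (cases "(v, u) \<in> parcs (transfer_graph m)")
      case True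
      note u = transfer_graph_arc_heights[OF True]
      have "u = (snd v, snd v + snd (step_vector (step_along u)))"
        using u(3) snd_step_vector_step_along[OF u(2)] by (simp add: prod_eq_iff)
      with True show ?thesis
        by (metis step_along_step_vector)
    qed simp
    have "w \<in> ?R \<longleftrightarrow> (\<exists>u. ((v, u) \<in> parcs (transfer_graph m) \<and> s = step_along u)
        \<and> w' \<in> continuations m u n)"
      unfolding Cons by auto
    also have "\<dots> \<longleftrightarrow> w \<in> ?L"
      unfolding target Cons Cons_in_continuations_iff[OF assms] by (metis (no_types, lifting))
    finally show ?thesis ..
  qed
qed

lemma card_continuations:
  "v \<in> transfer_vertices m \<Longrightarrow> card (continuations m v n) = num_walks (transfer_graph m) v n"
proof (induction n arbitrary: v)
  case 0
  \<comment> \<open>The empty path qualifies because the height of the vertex \<open>v\<close> is in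
    range.\<close>
  then have "continuations m v 0 = {[]}"
    by (auto simp: continuations_def transfer_vertices_def)
  then show ?case by simp
next
  case (Suc n)
  let ?U = "{u. (v, u) \<in> parcs (transfer_graph m)}"
  have U: "?U \<subseteq> transfer_vertices m"
    using transfer_graph_arc_heights(2) by blast
  \<comment> \<open>Out-neighbours of \<open>v\<close> share their first entry, and the step fixes
    the difference of the entries. Hence the sets in the union have distinct first letters and are
    disjoint.\<close>
  have "u = u'" if "u \<in> ?U" "u' \<in> ?U" "step_along u = step_along u'" for u u'
  proof (rule prod_eqI)
    have arcs: "(v, u) \<in> parcs (transfer_graph m)" "(v, u') \<in> parcs (transfer_graph m)"
      using that(1,2) by simp_all
    note u = transfer_graph_arc_heights[OF arcs(1)] and u' = transfer_graph_arc_heights[OF arcs(2)]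
    show "fst u = fst u'"
      by (simp only: u(3) u'(3))
    moreover have "snd u - fst u = snd u' - fst u'"
      using snd_step_vector_step_along[OF u(2)] snd_step_vector_step_along[OF u'(2)] that(3)
      by simp
    ultimately show "snd u = snd u'" by simp
  qed
  then have "card (continuations m v (Suc n)) =
      (\<Sum>u\<in>?U. card (Cons (step_along u) ` continuations m u n))"
    unfolding continuations_Suc[OF Suc.prems]
    by (intro card_UN_disjoint)
      (auto intro: finite_subset[OF U finite_transfer_vertices] finite_continuations)
  also have "\<dots> = (\<Sum>u\<in>?U. num_walks (transfer_graph m) u n)"
    using Suc.IH U by (intro sum.cong) (auto simp: card_image)
  finally show ?case by simp
qed

theorem theorem2p6:
  fixes m :: nat and vs :: "(int \<times> int) list"
  assumes "m > 0"
    and "is_transfer_enumeration m vs"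
  shows "Abs_fps (\<lambda>n. of_nat (num_monotone_paths m n)) =
     det (replace_col (transfer_matrix m vs) (vec (length vs) (\<lambda>_. 1)) 0) /
     det (transfer_matrix m vs)"
proof -
  have vs: "distinct vs" "set vs = transfer_vertices m" "hd vs = (0, 0)"
    using assms(2) by (auto simp: is_transfer_enumeration_def transfer_graph_def)
  have origin: "(0, 0) \<in> transfer_vertices m"
    by (simp add: transfer_vertices_def)
  \<comment> \<open>Since \<open>hd []\<close> is unspecified, nonemptiness must be known before
    \<open>hd vs\<close> can be read as \<open>vs ! 0\<close>.\<close>
  with vs have "vs \<noteq> []" by auto
  with vs(3) have vs0: "0 < length vs" "vs ! 0 = (0, 0)"
    by (auto simp: hd_conv_nth)
  have arcs: "snd ` parcs (transfer_graph m) \<subseteq> set vs"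
    unfolding vs(2) using transfer_graph_arc_heights(2) by auto
  have "Abs_fps (\<lambda>n. of_nat (num_monotone_paths m n)) =
      (walk_fps (transfer_graph m) (0, 0) :: rat fps)"
    by (simp add: walk_fps_def num_monotone_paths_def monotone_paths_eq_continuations
        card_continuations[OF origin])
  \<comment> \<open>A series with constant term 1 is nonzero, which permits the final
    cancellation.\<close>
  moreover have "det (transfer_matrix m vs) \<noteq> 0"
    using det_one_minus_X_smult_nth_0[OF adjacency_matrix_carrier]
    by (metis fps_zero_nth transfer_matrix_def zero_neq_one)
  moreover have "walk_fps (transfer_graph m) (0, 0) * det (transfer_matrix m vs) =
      det (replace_col (transfer_matrix m vs) (vec (length vs) (\<lambda>_. 1)) 0)"
    using walk_fps_times_det[OF vs(1) arcs vs0(1)] by (simp add: vs0(2) transfer_matrix_def)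
  ultimately show ?thesis
    by (metis nonzero_mult_div_cancel_right)
qed

end
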